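(* Let $V\in\mathbb{R}^{n\times k}$ be a matrix with orthonormal columns ($V^TV=I$), let $v_i\in\mathbb{R}^k$ denote the $i$-th row of $V$, and let $S=\{v_1,\dots,v_n\}$. Let $\mathcal{P}$ be the set of all normalized partition matrices of size $n\times k$, and for $P\in\mathcal{P}$ let $\mathrm{Cost}(P)$ be the $k$-means cost of the partition induced by $P$ with respect to $S$. Then for all $P\in\mathcal{P}$, $$\|I-V^TPP^TV\|_1=\mathrm{Cost}(P),$$ where $\|\cdot\|_1$ denotes the nuclear norm (the sum of the singular values).
   Context: A normalized partition matrix of size $n\times k$ is a matrix $P\in\mathbb{R}^{n\times k}$ arising from a partition of $\{1,\dots,n\}$ into $k$ disjoint nonempty clusters $C_1,\dots,C_k$ covering $\{1,\dots,n\}$ via $P_{ij}=1/\sqrt{|C_j|}$ if $i\in C_j$ and $P_{ij}=0$ otherwise; in particular $P^TP=I$. The partition induced by $P$ groups the points $v_1,\dots,v_n$ (indexed by $i$, so repeated points are counted with multiplicity) into these clusters, and its $k$-means cost is $\mathrm{Cost}(P)=\sum_{j=1}^k\sum_{i\in C_j}\|v_i-g_j\|_2^2$, where $g_j=\frac{1}{|C_j|}\sum_{i\in C_j}v_i$ is the centroid of the $j$-th cluster. *)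

theory Defs
  imports "HOL-Analysis.Analysis"
begin

text \<open>A real \<open>n \<times> k\<close> matrix is \<open>A :: real^'k^'n\<close>, with rows indexed by \<open>'n\<close> and columns by \<open>'k\<close>.
  Clusters are labelled by the column index and consist of row indices.\<close>

definition cluster_partition :: "('k::finite \<Rightarrow> 'n::finite set) \<Rightarrow> bool" where
  "cluster_partition C \<longleftrightarrow> (\<forall>j. C j \<noteq> {}) \<and> disjoint_family C \<and> (\<Union>j. C j) = UNIV"

definition partition_matrix :: "('k::finite \<Rightarrow> 'n::finite set) \<Rightarrow> real^'k^'n" where
  "partition_matrix C = (\<chi> i j. if i \<in> C j then 1 / sqrt (real (card (C j))) else 0)"

definition normalized_partition_matrices :: "(real^'k^'n) set" where
  "normalized_partition_matrices = {partition_matrix C | C. cluster_partition C}"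

text \<open>The clusters can be read off the matrix as the supports of its columns;
  see \<open>cluster_partition_matrix\<close> below.\<close>

definition cluster :: "real^'k^'n \<Rightarrow> 'k \<Rightarrow> 'n set" where
  "cluster P j = {i. P $ i $ j \<noteq> 0}"

lemma cluster_partition_matrix: "cluster (partition_matrix C) = C"
proof
  fix j
  have "card (C j) \<noteq> 0" if "i \<in> C j" for i
    using that by auto
  then show "cluster (partition_matrix C) j = C j"
    by (auto simp: cluster_def partition_matrix_def)
qed

definition centroid :: "('n \<Rightarrow> 'a::real_vector) \<Rightarrow> 'n set \<Rightarrow> 'a" where
  "centroid v C = (1 / real (card C)) *\<^sub>R (\<Sum>i\<in>C. v i)"

text \<open>The points are an indexed family, so repeated points count with multiplicity.\<close>

definition kmeans_cost :: "('n::finite \<Rightarrow> 'a::real_normed_vector) \<Rightarrow> real^'k^'n \<Rightarrow> real" where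
  "kmeans_cost v P =
     (\<Sum>j\<in>UNIV. \<Sum>i\<in>cluster P j. (norm (v i - centroid v (cluster P j)))\<^sup>2)"

text \<open>The singular values of \<open>A\<close> are the \<open>\<sigma> \<ge> 0\<close> for which \<open>\<sigma>\<^sup>2\<close> is an eigenvalue of \<open>A\<^sup>T A\<close>,
  counted with the multiplicity of that eigenvalue. Since \<open>A\<^sup>T A\<close> is symmetric, its algebraic and
  geometric multiplicities agree.\<close>

definition singular_space :: "real^'n^'m \<Rightarrow> real \<Rightarrow> (real^'n) set" where
  "singular_space A \<sigma> = {x. (transpose A ** A) *v x = \<sigma>\<^sup>2 *\<^sub>R x}"

definition singular_values :: "real^'n^'m \<Rightarrow> real set" where
  "singular_values A = {\<sigma>. \<sigma> \<ge> 0 \<and> (\<exists>x\<in>singular_space A \<sigma>. x \<noteq> 0)}"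

definition nuclear_norm :: "real^'n^'m \<Rightarrow> real" where
  "nuclear_norm A = (\<Sum>\<sigma>\<in>singular_values A. real (dim (singular_space A \<sigma>)) * \<sigma>)"

lemma finite_singular_values: "finite (singular_values (A :: real^'n^'m))"
proof -
  define B where "B = transpose A ** A"
  have sym: "(B *v x) \<bullet> y = x \<bullet> (B *v y)" for x y
    by (metis B_def dot_lmul_matrix matrix_transpose_mul transpose_matrix_vector transpose_transpose)
  have "\<forall>\<sigma>\<in>singular_values A. \<exists>x. x \<noteq> 0 \<and> B *v x = \<sigma>\<^sup>2 *\<^sub>R x"
    unfolding singular_values_def singular_space_def B_def by blast
  then obtain f where f: "\<And>\<sigma>. \<sigma> \<in> singular_values A \<Longrightarrow> f \<sigma> \<noteq> 0"
      "\<And>\<sigma>. \<sigma> \<in> singular_values A \<Longrightarrow> B *v f \<sigma> = \<sigma>\<^sup>2 *\<^sub>R f \<sigma>"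
    by metis
  have orth: "f \<sigma> \<bullet> f \<tau> = 0"
    if "\<sigma> \<in> singular_values A" "\<tau> \<in> singular_values A" "\<sigma> \<noteq> \<tau>" for \<sigma> \<tau>
  proof -
    have "\<sigma>\<^sup>2 * (f \<sigma> \<bullet> f \<tau>) = \<tau>\<^sup>2 * (f \<sigma> \<bullet> f \<tau>)"
      using sym[of "f \<sigma>" "f \<tau>"] f that by simp
    moreover have "\<sigma>\<^sup>2 \<noteq> \<tau>\<^sup>2"
      using that by (auto simp: singular_values_def power2_eq_iff_nonneg)
    ultimately show ?thesis by simp
  qed
  have inj: "inj_on f (singular_values A)"
    by (rule inj_onI) (metis f(1) orth inner_eq_zero_iff)
  have "pairwise orthogonal (f ` singular_values A)"
    unfolding pairwise_def orthogonal_def using orth by auto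
  moreover have "0 \<notin> f ` singular_values A"
    using f(1) by force
  ultimately have "independent (f ` singular_values A)"
    by (rule pairwise_orthogonal_independent)
  then have "finite (f ` singular_values A)"
    by (rule independent_imp_finite)
  with inj show ?thesis
    by (simp add: finite_image_iff)
qed

end

theory Submission
  imports Defs
begin

text \<open>The matrix \<open>A = I - V\<^sup>T P P\<^sup>T V\<close> is symmetric, and since \<open>V\<close> and \<open>P\<close> have orthonormal columns
  it is positive semidefinite: \<open>x \<bullet> A x = \<parallel>V x\<parallel>\<^sup>2 - \<parallel>P\<^sup>T V x\<parallel>\<^sup>2 \<ge> 0\<close>. By the spectral theorem its
  nuclear norm is therefore its trace, which is \<open>\<parallel>V\<parallel>\<^sub>F\<^sup>2 - \<parallel>P\<^sup>T V\<parallel>\<^sub>F\<^sup>2\<close>. The rows of \<open>P\<^sup>T V\<close> are the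
  cluster sums divided by \<open>sqrt \<bar>C\<^sub>j\<bar>\<close>, so the parallel axis identity
  \<open>(\<Sum>i\<in>C. \<parallel>v\<^sub>i - g\<parallel>\<^sup>2) = (\<Sum>i\<in>C. \<parallel>v\<^sub>i\<parallel>\<^sup>2) - \<parallel>\<Sum>i\<in>C. v\<^sub>i\<parallel>\<^sup>2 / \<bar>C\<bar>\<close> identifies it with the cost.\<close>

section \<open>The spectral theorem\<close>

text \<open>First-order condition at a maximum: the polynomial in \<open>t\<close> is largest at
  \<open>t = 0\<close>, so its derivative \<open>2 * a\<close> there vanishes.\<close>

lemma linear_term_zero_if_quadratic_nonpos:
  fixes a b :: real
  assumes "\<And>t. 2 * t * a + t\<^sup>2 * b \<le> 0"
  shows "a = 0"
proof (rule ccontr)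
  assume "a \<noteq> 0"
  \<comment> \<open>Taking \<open>t = a / d\<close> turns the polynomial into
    \<open>(a / d)\<^sup>2 * (2 * d + b)\<close>, which is positive since \<open>d\<close> exceeds
    the absolute value of \<open>b\<close>.\<close>
  define d where "d = \<bar>b\<bar> + 1"
  have d: "d > 0" "\<bar>b\<bar> \<le> d" by (auto simp: d_def)
  have "2 * (a / d) * a + (a / d)\<^sup>2 * b = (a / d)\<^sup>2 * (2 * d + b)"
    using d by (simp add: field_simps power2_eq_square)
  moreover have "(a / d)\<^sup>2 * (2 * d + b) > 0"
    using d \<open>a \<noteq> 0\<close> by (intro mult_pos_pos) auto
  ultimately show False
    using assms[of "a / d"] by linarith
qed

text \<open>The Rayleigh quotient attains its maximum on the compact unit sphere of
  \<open>S\<close>; a maximiser is an eigenvector, with the maximum as eigenvalue.\<close>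

lemma selfadjoint_eigenvector_exists:
  fixes f :: "'a::euclidean_space \<Rightarrow> 'a"
  assumes lin: "linear f" and sa: "\<And>x y. f x \<bullet> y = x \<bullet> f y"
    and S: "subspace S" "f ` S \<subseteq> S" "S \<noteq> {0}"
  obtains x c where "x \<in> S" "norm x = 1" "f x = c *\<^sub>R x"
proof -
  define K where "K = S \<inter> sphere 0 1"
  have "compact K"
    unfolding K_def using S(1) by (intro closed_Int_compact closed_subspace compact_sphere)
  moreover obtain y where y: "y \<in> S" "y \<noteq> 0"
    using S subspace_0 by blast
  have "y /\<^sub>R norm y \<in> K"
    using y S(1) by (simp add: K_def subspace_scale)
  then have "K \<noteq> {}" by blast
  moreover have "continuous_on K (\<lambda>x. x \<bullet> f x)"
    using lin by (intro continuous_intros linear_continuous_on linear_conv_bounded_linear[THEN iffD1])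
  ultimately obtain x where x: "x \<in> K" and max: "\<And>y. y \<in> K \<Longrightarrow> y \<bullet> f y \<le> x \<bullet> f x"
    using continuous_attains_sup[of K "\<lambda>x. x \<bullet> f x"] by auto
  define c where "c = x \<bullet> f x"
  have xS: "x \<in> S" and xn: "norm x = 1"
    using x by (auto simp: K_def)
  have le: "y \<bullet> f y \<le> c * (y \<bullet> y)" if "y \<in> S" for y
  proof (cases "y = 0")
    case True
    then show ?thesis by (simp add: linear_0[OF lin])
  next
    case False
    have "y /\<^sub>R norm y \<in> K"
      using that False S(1) by (simp add: K_def subspace_scale)
    from max[OF this] have "(y \<bullet> f y) / (norm y)\<^sup>2 \<le> c"
      by (simp add: c_def linear_scale[OF lin] power2_eq_square divide_inverse mult_ac)
    then show ?thesis
      using False by (simp add: divide_le_eq power2_norm_eq_inner)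
  qed
  \<comment> \<open>The residual \<open>w\<close> is to vanish. It lies in \<open>S\<close> by
    invariance, so \<open>x\<close> may be perturbed along it.\<close>
  define w where "w = f x - c *\<^sub>R x"
  have wS: "w \<in> S"
    using S xS by (auto simp: w_def intro!: subspace_diff subspace_scale)
  \<comment> \<open>This is \<open>le\<close> at \<open>x + t *\<^sub>R w\<close>: the terms
    constant in \<open>t\<close> cancel, and self-adjointness makes the linear coefficient
    \<open>2 * (w \<bullet> w)\<close>.\<close>
  have "2 * t * (w \<bullet> w) + t\<^sup>2 * (w \<bullet> f w - c * (w \<bullet> w)) \<le> 0" for t
  proof -
    have "x + t *\<^sub>R w \<in> S"
      using S xS wS by (auto intro!: subspace_add subspace_scale)
    from le[OF this] have
      "(x + t *\<^sub>R w) \<bullet> (f x + t *\<^sub>R f w) \<le> c * ((x + t *\<^sub>R w) \<bullet> (x + t *\<^sub>R w))"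
      by (simp add: linear_add[OF lin] linear_scale[OF lin])
    moreover have "x \<bullet> x = 1"
      using xn by (simp add: dot_square_norm)
    moreover have "x \<bullet> f w = w \<bullet> f x"
      using sa[of x w] by (simp add: inner_commute)
    moreover have "w \<bullet> f x = w \<bullet> w + c * (w \<bullet> x)"
      by (simp add: w_def inner_diff_right)
    ultimately show ?thesis
      by (simp add: inner_add_left inner_add_right c_def[symmetric] inner_commute[of x w]
          algebra_simps power2_eq_square)
  qed
  then have "w \<bullet> w = 0"
    by (rule linear_term_zero_if_quadratic_nonpos)
  then have "f x = c *\<^sub>R x"
    by (simp add: w_def)
  with xS xn that show thesis by blast
qed

text \<open>Induction on the dimension: split off a unit eigenvector \<open>x\<close> and pass to
  its orthogonal complement in \<open>S\<close>, which self-adjointness keeps invariant.\<close>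

lemma selfadjoint_eigenbasis_exists:
  fixes f :: "'a::euclidean_space \<Rightarrow> 'a"
  assumes lin: "linear f" and sa: "\<And>x y. f x \<bullet> y = x \<bullet> f y"
    and S: "subspace S" "f ` S \<subseteq> S"
  shows "\<exists>B \<subseteq> S. span B = S \<and> pairwise orthogonal B \<and> (\<forall>b\<in>B. norm b = 1 \<and> (\<exists>c. f b = c *\<^sub>R b))"
  using S
proof (induction "dim S" arbitrary: S rule: less_induct)
  case less
  show ?case
  proof (cases "S = {0}")
    case True
    then show ?thesis by (intro exI[of _ "{}"]) (auto simp: pairwise_def)
  next
    case False
    then obtain x c where x: "x \<in> S" "norm x = 1" "f x = c *\<^sub>R x"
      using selfadjoint_eigenvector_exists[OF lin sa less.prems] by metis
    have xx: "x \<bullet> x = 1"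
      using x by (simp add: dot_square_norm)
    define T where "T = S \<inter> {y. x \<bullet> y = 0}"
    have T: "subspace T"
      unfolding T_def by (intro subspace_inter less.prems subspace_hyperplane)
    have fT: "f ` T \<subseteq> T"
    proof
      fix z assume "z \<in> f ` T"
      then obtain y where y: "z = f y" "y \<in> S" "x \<bullet> y = 0"
        by (auto simp: T_def)
      have "x \<bullet> f y = 0"
        using sa[of x y] x(3) y(3) by simp
      then show "z \<in> T"
        using y less.prems by (auto simp: T_def)
    qed
    have "x \<notin> T"
      using xx by (simp add: T_def)
    moreover have "T \<subseteq> S"
      by (simp add: T_def)
    ultimately have "T \<subset> S"
      using x(1) by blast
    then have "dim T < dim S"
      by (metis T less.prems(1) dim_psubset span_eq_iff)
    from less.hyps[OF this T fT] obtain B where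
      B: "B \<subseteq> T" "span B = T" "pairwise orthogonal B"
         "\<forall>b\<in>B. norm b = 1 \<and> (\<exists>c. f b = c *\<^sub>R b)" by blast
    have "S \<subseteq> span (insert x B)"
    proof
      fix y assume "y \<in> S"
      then have "y - (x \<bullet> y) *\<^sub>R x \<in> T"
        using less.prems x xx
        by (auto simp: T_def inner_diff_right intro!: subspace_diff subspace_scale)
      then show "y \<in> span (insert x B)"
        using B(2) span_breakdown_eq by blast
    qed
    moreover have "insert x B \<subseteq> S"
      using B(1) x by (auto simp: T_def)
    moreover from this have "span (insert x B) \<subseteq> S"
      using less.prems(1) by (rule span_minimal)
    moreover have "pairwise orthogonal (insert x B)"
      using B(1,3) by (auto simp: pairwise_insert orthogonal_def T_def inner_commute)
    ultimately show ?thesis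
      using B(4) x by (intro exI[of _ "insert x B"]) auto
  qed
qed

text \<open>The Gram-Schmidt residual of \<open>x\<close> is orthogonal to the span of
  \<open>B\<close>, here the whole space, hence to itself.\<close>

lemma orthonormal_expansion:
  fixes x :: "'a::euclidean_space"
  assumes "span B = UNIV" "pairwise orthogonal B" "\<And>b. b \<in> B \<Longrightarrow> norm b = 1"
  shows "x = (\<Sum>b\<in>B. (x \<bullet> b) *\<^sub>R b)"
proof -
  have "orthogonal (x - (\<Sum>b\<in>B. (b \<bullet> x / (b \<bullet> b)) *\<^sub>R b)) y" for y
    using Gram_Schmidt_step[of B y x] assms by (simp add: orthogonal_commute)
  then have "x - (\<Sum>b\<in>B. (b \<bullet> x / (b \<bullet> b)) *\<^sub>R b) = 0"
    using orthogonal_self by blast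
  moreover have "(\<Sum>b\<in>B. (b \<bullet> x / (b \<bullet> b)) *\<^sub>R b) = (\<Sum>b\<in>B. (x \<bullet> b) *\<^sub>R b)"
    by (intro sum.cong) (use assms(3) in \<open>auto simp: dot_square_norm inner_commute\<close>)
  ultimately show ?thesis by simp
qed

section \<open>The nuclear norm of a positive semidefinite matrix\<close>

text \<open>Expand the image of each coordinate vector along \<open>B\<close>, then exchange the two
  sums.\<close>

lemma trace_orthonormal_basis:
  fixes A :: "real^'n^'n"
  assumes B: "span B = UNIV" "pairwise orthogonal B" "\<And>b. b \<in> B \<Longrightarrow> norm b = 1"
  shows "trace A = (\<Sum>b\<in>B. b \<bullet> (A *v b))"
proof -
  have "trace A = (\<Sum>i\<in>UNIV. axis i 1 \<bullet> (A *v axis i 1))"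
    by (simp add: trace_def inner_axis' matrix_vector_mul_component inner_axis)
  also have "\<dots> = (\<Sum>i\<in>UNIV. \<Sum>b\<in>B. b $ i * (A *v b) $ i)"
  proof (intro sum.cong refl)
    fix i :: 'n
    have "A *v axis i 1 = A *v (\<Sum>b\<in>B. (axis i 1 \<bullet> b) *\<^sub>R b)"
      using orthonormal_expansion[OF B] by metis
    also have "\<dots> = (\<Sum>b\<in>B. b $ i *\<^sub>R (A *v b))"
      by (simp add: inner_axis' linear_sum[OF matrix_vector_mul_linear]
          linear_scale[OF matrix_vector_mul_linear])
    finally show "axis i 1 \<bullet> (A *v axis i 1) = (\<Sum>b\<in>B. b $ i * (A *v b) $ i)"
      by (simp add: inner_axis')
  qed
  also have "\<dots> = (\<Sum>b\<in>B. b \<bullet> (A *v b))"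
    by (subst sum.swap) (simp add: inner_vec_def)
  finally show ?thesis .
qed

lemma inner_symmetric_matrix:
  fixes A :: "real^'n^'n"
  assumes "transpose A = A"
  shows "(A *v x) \<bullet> y = x \<bullet> (A *v y)"
  by (metis assms dot_lmul_matrix transpose_matrix_vector)

text \<open>In an orthonormal eigenbasis the eigenvalues are nonnegative, so they are the singular
  values themselves, and both sides are their sum with multiplicity.\<close>

lemma nuclear_norm_eq_trace:
  fixes A :: "real^'n^'n"
  assumes sym: "transpose A = A" and psd: "\<And>x. 0 \<le> x \<bullet> (A *v x)"
  shows "nuclear_norm A = trace A"
proof -
  note sa = inner_symmetric_matrix[OF sym]
  obtain B where B: "span B = UNIV" "pairwise orthogonal B" "\<And>b. b \<in> B \<Longrightarrow> norm b = 1"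
    and "\<And>b. b \<in> B \<Longrightarrow> \<exists>c. A *v b = c *\<^sub>R b"
    using selfadjoint_eigenbasis_exists[OF matrix_vector_mul_linear sa subspace_UNIV] by blast
  then obtain l where l: "\<And>b. b \<in> B \<Longrightarrow> A *v b = l b *\<^sub>R b"
    by metis
  have bb: "b \<bullet> b = 1" if "b \<in> B" for b
    using B(3)[OF that] by (simp add: dot_square_norm)
  have l_inner: "b \<bullet> (A *v b) = l b" if "b \<in> B" for b
    using that l bb by simp
  have l_nonneg: "0 \<le> l b" if "b \<in> B" for b
    using psd[of b] l_inner[OF that] by simp
  have nz: "0 \<notin> B"
    using B(3) by force
  have ind: "independent B"
    using B(2) nz by (rule pairwise_orthogonal_independent)
  then have fin: "finite B"
    by (rule independent_imp_finite)
  have AA: "(transpose A ** A) *v x = A *v (A *v x)" for x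
    by (simp add: sym matrix_vector_mul_assoc)
  \<comment> \<open>\<open>transpose A ** A\<close> acts on \<open>b\<close> as
    \<open>(l b)\<^sup>2\<close>. As \<open>l b\<close> and \<open>\<sigma>\<close> are both
    nonnegative, equal squares force \<open>l b = \<sigma>\<close>; an eigenvalue
    \<open>-\<sigma>\<close> cannot contribute.\<close>
  have space: "singular_space A \<sigma> = span {b\<in>B. l b = \<sigma>}" if \<sigma>: "\<sigma> \<ge> 0" for \<sigma>
  proof
    show "span {b\<in>B. l b = \<sigma>} \<subseteq> singular_space A \<sigma>"
    proof (rule span_minimal)
      show "{b\<in>B. l b = \<sigma>} \<subseteq> singular_space A \<sigma>"
        by (auto simp: singular_space_def AA l power2_eq_square
            linear_scale[OF matrix_vector_mul_linear])
      show "subspace (singular_space A \<sigma>)"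
        by (auto simp: singular_space_def subspace_def matrix_vector_right_distrib scaleR_add_right
            linear_scale[OF matrix_vector_mul_linear])
    qed
    show "singular_space A \<sigma> \<subseteq> span {b\<in>B. l b = \<sigma>}"
    proof
      fix x assume "x \<in> singular_space A \<sigma>"
      then have x: "A *v (A *v x) = \<sigma>\<^sup>2 *\<^sub>R x"
        by (simp add: singular_space_def AA)
      \<comment> \<open>Eigenvectors of a symmetric matrix for different eigenvalues are
        orthogonal.\<close>
      have "x \<bullet> b = 0" if b: "b \<in> B" "l b \<noteq> \<sigma>" for b
      proof -
        have "(A *v (A *v x)) \<bullet> b = (l b)\<^sup>2 * (x \<bullet> b)"
          using b by (simp add: sa l linear_scale[OF matrix_vector_mul_linear] power2_eq_square)
        then have "\<sigma>\<^sup>2 * (x \<bullet> b) = (l b)\<^sup>2 * (x \<bullet> b)"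
          using x by simp
        moreover have "\<sigma>\<^sup>2 \<noteq> (l b)\<^sup>2"
          using b \<sigma> l_nonneg by (auto simp: power2_eq_iff_nonneg)
        ultimately show ?thesis by simp
      qed
      then have "(x \<bullet> b) *\<^sub>R b \<in> span {b\<in>B. l b = \<sigma>}" if "b \<in> B" for b
        using that by (cases "l b = \<sigma>") (auto intro: span_scale span_base span_zero)
      then have "(\<Sum>b\<in>B. (x \<bullet> b) *\<^sub>R b) \<in> span {b\<in>B. l b = \<sigma>}"
        by (intro span_sum)
      then show "x \<in> span {b\<in>B. l b = \<sigma>}"
        using orthonormal_expansion[OF B, of x] by simp
    qed
  qed
  have dim: "dim (singular_space A \<sigma>) = card {b\<in>B. l b = \<sigma>}" if "\<sigma> \<ge> 0" for \<sigma>
    unfolding space[OF that] dim_span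
    by (rule dim_eq_card_independent, rule independent_mono[OF ind]) auto
  have vals: "singular_values A = l ` B"
  proof
    show "singular_values A \<subseteq> l ` B"
    proof
      fix \<sigma> assume "\<sigma> \<in> singular_values A"
      then obtain x where "\<sigma> \<ge> 0" "x \<in> singular_space A \<sigma>" "x \<noteq> 0"
        by (auto simp: singular_values_def)
      then have "span {b\<in>B. l b = \<sigma>} \<noteq> {0}"
        using space by blast
      then have "{b\<in>B. l b = \<sigma>} \<noteq> {}"
        by (metis span_empty)
      then show "\<sigma> \<in> l ` B" by blast
    qed
    show "l ` B \<subseteq> singular_values A"
    proof
      fix \<sigma> assume "\<sigma> \<in> l ` B"
      then obtain b where b: "b \<in> B" "\<sigma> = l b" by blast
      then have "b \<in> singular_space A \<sigma>"
        using space[of \<sigma>] l_nonneg by (auto intro: span_base)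
      then show "\<sigma> \<in> singular_values A"
        using b nz l_nonneg by (auto simp: singular_values_def intro!: bexI[of _ b])
    qed
  qed
  \<comment> \<open>Each multiplicity is the size of a fibre of \<open>l\<close>, so the weighted
    sum becomes a sum over \<open>B\<close> grouped by eigenvalue.\<close>
  have "nuclear_norm A = (\<Sum>\<sigma>\<in>l ` B. \<Sum>b\<in>{b\<in>B. l b = \<sigma>}. l b)"
    unfolding nuclear_norm_def vals using dim l_nonneg by (intro sum.cong) auto
  also have "\<dots> = (\<Sum>b\<in>B. l b)"
    using fin by (rule sum.image_gen[symmetric])
  also have "\<dots> = trace A"
    using trace_orthonormal_basis[OF B, of A] by (simp add: l_inner)
  finally show ?thesis .
qed

section \<open>Partition matrices and the cost\<close>

lemma inner_matrix_transpose:
  fixes A :: "real^'n^'m"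
  shows "x \<bullet> (transpose A *v y) = (A *v x) \<bullet> y"
  by (metis dot_lmul_matrix inner_commute transpose_matrix_vector)

lemma inner_gram_matrix:
  fixes A :: "real^'n^'m"
  shows "x \<bullet> ((transpose A ** A) *v x) = (norm (A *v x))\<^sup>2"
  by (metis inner_matrix_transpose matrix_vector_mul_assoc power2_norm_eq_inner)

lemma norm_orthonormal_columns:
  fixes A :: "real^'n^'m"
  assumes "transpose A ** A = mat 1"
  shows "norm (A *v x) = norm x"
  using inner_gram_matrix[of x A] assms by (simp add: dot_square_norm)

text \<open>Moving \<open>A\<close> across the inner product and applying Cauchy-Schwarz leaves a
  common factor to cancel, because \<open>A\<close> itself preserves norms.\<close>

lemma norm_transpose_orthonormal_columns_le:
  fixes A :: "real^'n^'m"
  assumes "transpose A ** A = mat 1"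
  shows "norm (transpose A *v y) \<le> norm y"
proof -
  have "(norm (transpose A *v y))\<^sup>2 = (A *v (transpose A *v y)) \<bullet> y"
    by (simp only: power2_norm_eq_inner inner_matrix_transpose)
  also have "\<dots> \<le> norm (transpose A *v y) * norm y"
    using norm_cauchy_schwarz[of "A *v (transpose A *v y)" y]
    by (simp add: norm_orthonormal_columns[OF assms])
  finally show ?thesis
    by (cases "transpose A *v y = 0") (auto simp: power2_eq_square)
qed

text \<open>Distinct columns have disjoint supports, and the squared entries of column
  \<open>a\<close> are \<open>card (C a)\<close> copies of \<open>1 / card (C a)\<close>.\<close>

lemma transpose_partition_matrix_mult:
  assumes "cluster_partition C"
  shows "transpose (partition_matrix C) ** partition_matrix C = mat 1"
proof -
  have "(\<Sum>i\<in>UNIV. partition_matrix C $ i $ a * partition_matrix C $ i $ b) = (if a = b then 1 else 0)"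
    (is "?s = _") for a b
  proof (cases "a = b")
    case True
    have "?s = (\<Sum>i\<in>C a. 1 / real (card (C a)))"
      unfolding True by (intro sum.mono_neutral_cong_right) (auto simp: partition_matrix_def)
    \<comment> \<open>An empty cluster would give a zero column and the diagonal entry 0.\<close>
    moreover have "card (C a) \<noteq> 0"
      using assms by (simp add: cluster_partition_def)
    ultimately show ?thesis
      using True by simp
  next
    case False
    then have "C a \<inter> C b = {}"
      using assms by (auto simp: cluster_partition_def disjoint_family_on_def)
    then have "?s = 0"
      by (intro sum.neutral) (auto simp: partition_matrix_def)
    with False show ?thesis by simp
  qed
  then show ?thesis
    by (simp add: vec_eq_iff matrix_matrix_mult_def transpose_def mat_def)
qed

text \<open>Both sides are the squared Frobenius norm, summed by columns on the left and by rows on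
  the right.\<close>

lemma trace_transpose_mult_self:
  fixes A :: "real^'n^'m"
  shows "trace (transpose A ** A) = (\<Sum>i\<in>UNIV. (norm (row i A))\<^sup>2)"
  unfolding trace_def power2_norm_eq_inner
  by (simp add: matrix_matrix_mult_def transpose_def inner_vec_def row_def) (rule sum.swap)

text \<open>Expand the squares. As the sum \<open>s\<close> equals \<open>card C\<close> times
  \<open>g\<close>, the terms with \<open>g\<close> combine to
  \<open>- (s \<bullet> s) / card C\<close>.\<close>

lemma sum_power2_norm_diff_centroid:
  fixes v :: "'n \<Rightarrow> 'a::real_inner"
  assumes "finite C" "C \<noteq> {}"
  shows "(\<Sum>i\<in>C. (norm (v i - centroid v C))\<^sup>2)
    = (\<Sum>i\<in>C. (norm (v i))\<^sup>2) - (norm (\<Sum>i\<in>C. v i))\<^sup>2 / real (card C)"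
proof -
  define g s where "g = centroid v C" and "s = (\<Sum>i\<in>C. v i)"
  have n: "real (card C) > 0"
    using assms by (simp add: card_gt_0_iff)
  have g: "g = (1 / real (card C)) *\<^sub>R s"
    by (simp add: g_def s_def centroid_def)
  have "(\<Sum>i\<in>C. (norm (v i - g))\<^sup>2) = (\<Sum>i\<in>C. (norm (v i))\<^sup>2 - 2 * (v i \<bullet> g) + g \<bullet> g)"
    by (simp add: power2_norm_eq_inner inner_diff_left inner_diff_right inner_commute algebra_simps)
  also have "\<dots> = (\<Sum>i\<in>C. (norm (v i))\<^sup>2) - 2 * (s \<bullet> g) + real (card C) * (g \<bullet> g)"
    by (simp add: sum.distrib sum_subtractf s_def inner_sum_left sum_distrib_left)
  also have "\<dots> = (\<Sum>i\<in>C. (norm (v i))\<^sup>2) - (s \<bullet> s) / real (card C)"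
    using n by (simp add: g field_simps)
  finally show ?thesis
    by (simp add: g_def s_def power2_norm_eq_inner)
qed

text \<open>The squared norm of this row is the term subtracted in the parallel axis identity for
  \<open>C j\<close>.\<close>

lemma row_transpose_partition_matrix_mult:
  fixes V :: "real^'m^'n"
  shows "row j (transpose (partition_matrix C) ** V)
    = (1 / sqrt (real (card (C j)))) *\<^sub>R (\<Sum>i\<in>C j. row i V)"
proof -
  have "(\<Sum>i\<in>UNIV. partition_matrix C $ i $ j * V $ i $ a)
      = (\<Sum>i\<in>C j. V $ i $ a / sqrt (real (card (C j))))" for a
    by (intro sum.mono_neutral_cong_right) (auto simp: partition_matrix_def)
  then show ?thesis
    by (simp add: vec_eq_iff row_def matrix_matrix_mult_def transpose_def sum_divide_distrib)
qed

theorem theorem4p3: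
  fixes V P :: "real^'k^'n"
  assumes "transpose V ** V = mat 1"
    and "P \<in> normalized_partition_matrices"
  shows "nuclear_norm (mat 1 - transpose V ** P ** transpose P ** V) = kmeans_cost (\<lambda>i. row i V) P"
proof -
  obtain C where C: "cluster_partition C" and P: "P = partition_matrix C"
    using assms(2) by (auto simp: normalized_partition_matrices_def)
  define W where "W = transpose P ** V"
  \<comment> \<open>Writing the identity as \<open>transpose V ** V\<close> makes \<open>A\<close> a
    difference of Gram matrices, so its quadratic form and its trace are differences of squared
    norms.\<close>
  define A where "A = transpose V ** V - transpose W ** W"
  have A_eq: "mat 1 - transpose V ** P ** transpose P ** V = A"
    by (simp add: A_def W_def assms(1) matrix_transpose_mul matrix_mul_assoc)
  have "transpose A = A"
    by (simp add: A_def transpose_def matrix_matrix_mult_def vec_eq_iff mult.commute)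
  moreover have "0 \<le> x \<bullet> (A *v x)" for x
  proof -
    have "x \<bullet> (A *v x) = (norm (V *v x))\<^sup>2 - (norm (transpose P *v (V *v x)))\<^sup>2"
      unfolding A_def matrix_vector_mult_diff_rdistrib inner_diff_right inner_gram_matrix
      by (simp only: W_def matrix_vector_mul_assoc)
    then show ?thesis
      using norm_transpose_orthonormal_columns_le[OF transpose_partition_matrix_mult[OF C], of "V *v x"]
      unfolding P by (simp only: power_mono norm_ge_zero diff_ge_0_iff_ge)
  qed
  ultimately have "nuclear_norm A = trace A"
    by (rule nuclear_norm_eq_trace)
  also have "\<dots> = (\<Sum>i\<in>UNIV. (norm (row i V))\<^sup>2) - (\<Sum>j\<in>UNIV. (norm (row j W))\<^sup>2)"
    by (simp add: A_def trace_sub trace_transpose_mult_self)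
  \<comment> \<open>The clusters partition the row indices, so the sum can be taken cluster by
    cluster.\<close>
  also have "(\<Sum>i\<in>UNIV. (norm (row i V))\<^sup>2) = (\<Sum>j\<in>UNIV. \<Sum>i\<in>C j. (norm (row i V))\<^sup>2)"
  proof -
    have "(\<Sum>i\<in>(\<Union>j. C j). (norm (row i V))\<^sup>2) = (\<Sum>j\<in>UNIV. \<Sum>i\<in>C j. (norm (row i V))\<^sup>2)"
      using C by (intro sum.UNION_disjoint) (auto simp: cluster_partition_def disjoint_family_on_def)
    with C show ?thesis
      by (simp add: cluster_partition_def)
  qed
  also have "(\<Sum>j\<in>UNIV. (norm (row j W))\<^sup>2)
      = (\<Sum>j\<in>UNIV. (norm (\<Sum>i\<in>C j. row i V))\<^sup>2 / real (card (C j)))"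
    by (simp add: W_def P row_transpose_partition_matrix_mult power_divide)
  also have "(\<Sum>j\<in>UNIV. \<Sum>i\<in>C j. (norm (row i V))\<^sup>2) - \<dots> = kmeans_cost (\<lambda>i. row i V) P"
    using C unfolding kmeans_cost_def P cluster_partition_matrix sum_subtractf[symmetric]
    by (intro sum.cong) (simp_all add: sum_power2_norm_diff_centroid cluster_partition_def)
  finally show ?thesis
    unfolding A_eq .
qed

end
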